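(* The following properties hold for initial conditions $\eta$ such that $\sum_{x\le 0}e^{\theta_0x}\eta(x)<+\infty$ for some $\theta_0>0$. (i) Assume there is a $\theta>0$ such that $\liminf_{x\to-\infty}\eta(x)\exp(\theta x)=+\infty$. Then there exists $b>0$ such that $$\limsup_{t\to+\infty}\frac1t\log\mathbb P\left[\frac{r_t}{t}\le b\right]<0.$$ (ii) There exist $\theta'>0$ and $v'>v$ (not depending on $\eta$) such that, whenever $\liminf_{x\to-\infty}\eta(x)\exp(\theta'x)=+\infty$, $$\mathbb P\left[\liminf_{t\to+\infty}\frac{r_t}{t}\ge v'\right]=1.$$
   Context: Model. Fix an integer $a\ge1$. An initial condition is a map $\eta:\{\ldots,-2,-1,0\}\to\{0,1,2,\ldots\}$ with $\eta(x)\ge1$ for at least one $x$. At time $0$ there are $\eta(x)$ particles of type $X$ at each site $x\le 0$, and $a$ particles of type $Y$ at each site $x=1,2,\ldots$. The $Y$ particles do not move. The $X$ particles move as independent continuous-time simple symmetric random walks on $\mathbb Z$ with total jump rate $2$. When a site $x\in\{1,2,\ldots\}$ is visited by an $X$ particle for the first time, all $a$ $Y$ particles located at $x$ instantaneously become $X$ particles and start moving as independent walks of the same type, independent of all others. The front $r_t$ is the rightmost site visited by an $X$ particle up to time $t$, with the convention $r_0:=0$. Velocity. It is known that there is a deterministic constant $v$ with $0<v<+\infty$ (depending on $a$ but not on $\eta$) such that $\lim_{t\to+\infty}t^{-1}r_t=v$ almost surely whenever $\sum_{x\le0}e^{\theta x}\eta(x)<+\infty$ for a small enough $\theta>0$.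 *)

theory Defs
  imports "HOL-Probability.Probability"
begin

text \<open>
  A trajectory of a continuous-time simple symmetric random walk started at \<open>0\<close>, of total jump
  rate \<open>2\<close>, is encoded by a sequence of independent pairs (holding time, jump): exponential
  holding times of parameter \<open>2\<close> and independent uniform jumps \<open>\<plusminus>1\<close>.
\<close>

type_synonym trajectory = "nat \<Rightarrow> real \<times> int"

definition walk_law :: "trajectory measure" where
  "walk_law = (\<Pi>\<^sub>M k\<in>UNIV. density lborel (exponential_density 2) \<Otimes>\<^sub>M measure_pmf (pmf_of_set {-1, 1}))"

text \<open>If no \<open>k\<close> as below exists (explosion), the value is irrelevant: this is a null event.\<close>

definition jump_count :: "trajectory \<Rightarrow> real \<Rightarrow> nat" where
  "jump_count w t = (LEAST k. t < (\<Sum>j\<le>k. fst (w j)))"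

definition walk :: "trajectory \<Rightarrow> real \<Rightarrow> int" where
  "walk w t = (\<Sum>j<jump_count w t. snd (w j))"

definition hitting_time :: "trajectory \<Rightarrow> int \<Rightarrow> ereal" where
  "hitting_time w z = Inf {ereal s |s. 0 \<le> s \<and> walk w s = z}"

text \<open>
  The sample point \<open>\<omega>\<close> assigns to the particle labelled \<open>(x, i)\<close>, that is, the \<open>i\<close>-th particle
  located at \<open>x\<close> at time \<open>0\<close>, the displacement it performs from the moment at which it is of
  type X. A label is in use only if \<open>i < particles a \<eta> x\<close>. Only the values \<open>\<eta> x\<close> with \<open>x \<le> 0\<close> matter.
\<close>

type_synonym sample = "int \<times> nat \<Rightarrow> trajectory"

definition model :: "sample measure" where
  "model = (\<Pi>\<^sub>M p\<in>UNIV. walk_law)"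

definition particles :: "nat \<Rightarrow> (int \<Rightarrow> nat) \<Rightarrow> int \<Rightarrow> nat" where
  "particles a \<eta> x = (if x \<le> 0 then \<eta> x else a)"

text \<open>
  The time at which the particles initially at \<open>x\<close> are of type X: \<open>0\<close> for \<open>x \<le> 0\<close>, and the time
  of the first visit to \<open>x\<close> by an X particle for \<open>x \<ge> 1\<close>. Since jumps are \<open>\<plusminus>1\<close>, the sites
  \<open>1, 2, \<dots>\<close> are visited for the first time in increasing order, so the first particle to visit
  \<open>x\<close> is one that was initially at some \<open>y < x\<close>; this makes the recursion well-founded.
\<close>

function activation :: "nat \<Rightarrow> (int \<Rightarrow> nat) \<Rightarrow> sample \<Rightarrow> int \<Rightarrow> ereal" where
  "activation a \<eta> \<omega> x =
     (if x \<le> 0 then 0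
      else INF y\<in>{..<x}. INF i\<in>{..<particles a \<eta> y}.
             activation a \<eta> \<omega> y + hitting_time (\<omega> (y, i)) (x - y))"
  by pat_completeness auto
termination
  by (relation "Wellfounded.measure (\<lambda>(a, \<eta>, \<omega>, x). nat x)") auto

declare activation.simps [simp del]

text \<open>The sites visited by an X particle during \<open>[0, t]\<close>; \<open>s\<close> is the age of the particle as an X particle.\<close>

definition visited :: "nat \<Rightarrow> (int \<Rightarrow> nat) \<Rightarrow> sample \<Rightarrow> real \<Rightarrow> int set" where
  "visited a \<eta> \<omega> t =
     {x. \<exists>y i s. i < particles a \<eta> y \<and> 0 \<le> s \<and> activation a \<eta> \<omega> y + ereal s \<le> ereal t \<and>
                 x = y + walk (\<omega> (y, i)) s}"

definition front :: "nat \<Rightarrow> (int \<Rightarrow> nat) \<Rightarrow> sample \<Rightarrow> real \<Rightarrow> ereal" where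
  "front a \<eta> \<omega> t = (if t = 0 then 0 else SUP x\<in>visited a \<eta> \<omega> t. ereal (real_of_int x))"

definition initial_condition :: "(int \<Rightarrow> nat) \<Rightarrow> bool" where
  "initial_condition \<eta> \<longleftrightarrow> (\<exists>x\<le>0. \<eta> x \<ge> 1)"

definition exp_summable :: "real \<Rightarrow> (int \<Rightarrow> nat) \<Rightarrow> bool" where
  "exp_summable \<theta> \<eta> \<longleftrightarrow> (\<lambda>x::int. exp (\<theta> * real_of_int x) * real (\<eta> x)) summable_on {..0}"

text \<open>
  Since \<open>x \<le> 0\<close>, summability for some \<open>\<theta>\<close> implies summability for all larger ones; hence one
  fixed \<open>\<theta>\<close>, independent of \<open>\<eta>\<close>, expresses ``for a small enough \<open>\<theta>\<close>''.
\<close>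

definition is_velocity :: "nat \<Rightarrow> real \<Rightarrow> bool" where
  "is_velocity a v \<longleftrightarrow> 0 < v \<and>
     (\<exists>\<theta>>0. \<forall>\<eta>. initial_condition \<eta> \<and> exp_summable \<theta> \<eta> \<longrightarrow>
        (AE \<omega> in model. ((\<lambda>t. front a \<eta> \<omega> t / ereal t) \<longlongrightarrow> ereal v) at_top))"

text \<open>The logarithm on \<open>[0, \<infinity>)\<close> with \<open>log 0 = -\<infinity>\<close>, unlike \<open>ln 0 = 0\<close>.\<close>

definition ereal_ln :: "real \<Rightarrow> ereal" where
  "ereal_ln p = (if p \<le> 0 then - \<infinity> else ereal (ln p))"

text \<open>The events in question are measurable, so that \<open>measure model\<close> is meaningful on them.\<close>

lemma prob_space_walk_law: "prob_space walk_law"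
proof -
  have "prob_space (density lborel (exponential_density 2))"
    by (rule prob_space_exponential_density) simp
  then have "prob_space (density lborel (exponential_density 2) \<Otimes>\<^sub>M measure_pmf (pmf_of_set {-1, 1::int}))"
    by (rule prob_space_pair[OF _ prob_space_measure_pmf])
  then show ?thesis
    unfolding walk_law_def by (rule prob_space_PiM)
qed

lemma prob_space_model: "prob_space model"
  unfolding model_def by (rule prob_space_PiM) (rule prob_space_walk_law)

lemma walk_right_constant:
  "\<exists>u>s. \<forall>s'\<in>{s..<u}. walk w s' = walk w s"
proof (cases "\<exists>k. s < (\<Sum>j\<le>k. fst (w j))")
  case True
  define k where "k = jump_count w s"
  have k: "s < (\<Sum>j\<le>k. fst (w j))"
    unfolding k_def jump_count_def using True by (rule LeastI_ex)
  have "jump_count w s' = k" if "s' \<in> {s..<\<Sum>j\<le>k. fst (w j)}" for s'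
    unfolding jump_count_def
  proof (rule Least_equality)
    fix l assume "s' < (\<Sum>j\<le>l. fst (w j))"
    then have "s < (\<Sum>j\<le>l. fst (w j))" using that by auto
    then show "k \<le> l" unfolding k_def jump_count_def by (rule Least_le)
  qed (use that in auto)
  then show ?thesis
    using k by (intro exI[of _ "\<Sum>j\<le>k. fst (w j)"]) (auto simp: walk_def)
next
  case False
  have "walk w s' = walk w s" if "s' \<in> {s..<s + 1}" for s'
  proof -
    have "\<not> s < (\<Sum>j\<le>k. fst (w j))" "\<not> s' < (\<Sum>j\<le>k. fst (w j))" for k
      using False that by (auto simp: not_less intro: order_trans)
    then show ?thesis unfolding walk_def jump_count_def by simp
  qed
  then show ?thesis using less_add_one[of s] by blast
qed

lemma walk_at_rational:
  assumes "walk w s = z" "s < u"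
  obtains q :: rat where "s < real_of_rat q" "real_of_rat q < u" "walk w (real_of_rat q) = z"
proof -
  obtain u' where "u' > s" "\<forall>s'\<in>{s..<u'}. walk w s' = walk w s"
    using walk_right_constant[of s w] by auto
  moreover from this assms have "s < min u u'" by simp
  then obtain q where "s < real_of_rat q" "real_of_rat q < min u u'"
    using of_rat_dense by blast
  ultimately show ?thesis using that[of q] assms by simp
qed

lemma measurable_increment [measurable]:
  "(\<lambda>w. fst (w k)) \<in> borel_measurable walk_law"
  "(\<lambda>w. snd (w k)) \<in> walk_law \<rightarrow>\<^sub>M count_space UNIV"
proof -
  have *: "(\<lambda>w. w k) \<in> walk_law \<rightarrow>\<^sub>M
      density lborel (exponential_density 2) \<Otimes>\<^sub>M measure_pmf (pmf_of_set {-1, 1::int})"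
    unfolding walk_law_def by (rule measurable_component_singleton) simp
  show "(\<lambda>w. fst (w k)) \<in> borel_measurable walk_law"
    using measurable_compose[OF * measurable_fst] by simp
  show "(\<lambda>w. snd (w k)) \<in> walk_law \<rightarrow>\<^sub>M count_space UNIV"
    using measurable_compose[OF * measurable_snd] by simp
qed

lemma measurable_walk [measurable (raw)]:
  assumes [measurable]: "f \<in> M \<rightarrow>\<^sub>M walk_law" "g \<in> borel_measurable M"
  shows "(\<lambda>x. walk (f x) (g x)) \<in> M \<rightarrow>\<^sub>M count_space UNIV"
proof -
  have [measurable]: "(\<lambda>x. fst (f x k)) \<in> borel_measurable M"
    "(\<lambda>x. snd (f x k)) \<in> M \<rightarrow>\<^sub>M count_space UNIV" for k
    using measurable_compose[OF assms(1) measurable_increment(1)]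
      measurable_compose[OF assms(1) measurable_increment(2)] by auto
  have [measurable]: "(\<lambda>x. \<Sum>j<n. snd (f x j)) \<in> M \<rightarrow>\<^sub>M count_space UNIV" for n
  proof (induction n)
    case (Suc n)
    note [measurable] = Suc
    have "(\<lambda>x. (\<lambda>(p, q). p + q) (\<Sum>j<n. snd (f x j), snd (f x n))) \<in> M \<rightarrow>\<^sub>M count_space UNIV"
      by measurable
    then show ?case by simp
  qed simp
  have [measurable]: "(\<lambda>x. jump_count (f x) (g x)) \<in> M \<rightarrow>\<^sub>M count_space UNIV"
    unfolding jump_count_def by measurable
  show ?thesis unfolding walk_def
    by (rule measurable_compose_countable) measurable
qed

lemma hitting_time_rational:
  "hitting_time w z = (INF q::rat. if 0 \<le> q \<and> walk w (real_of_rat q) = z then ereal (real_of_rat q) else \<infinity>)"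
    (is "_ = ?R")
proof (rule antisym)
  show "hitting_time w z \<le> ?R"
    unfolding hitting_time_def by (intro INF_greatest) (auto intro!: Inf_lower)
  show "?R \<le> hitting_time w z"
    unfolding hitting_time_def
  proof (intro Inf_greatest, clarify)
    fix s :: real assume s: "0 \<le> s" "z = walk w s"
    show "(INF q::rat. if 0 \<le> q \<and> walk w (real_of_rat q) = walk w s
             then ereal (real_of_rat q) else \<infinity>) \<le> ereal s"
    proof (rule ereal_le_epsilon2)
      fix e :: real assume "0 < e"
      obtain q :: rat where q: "s < real_of_rat q" "real_of_rat q < s + e" "walk w (real_of_rat q) = z"
        using walk_at_rational[of w s z "s + e"] s \<open>0 < e\<close> by auto
      then have "0 < (real_of_rat q :: real)" using s by linarith
      then have "0 \<le> q" by simp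
      then show "(INF q::rat. if 0 \<le> q \<and> walk w (real_of_rat q) = walk w s
             then ereal (real_of_rat q) else \<infinity>) \<le> ereal s + ereal e"
        using q s by (intro INF_lower2[of q]) auto
    qed
  qed
qed

lemma measurable_hitting_time [measurable]:
  "(\<lambda>w. hitting_time w z) \<in> borel_measurable walk_law"
  unfolding hitting_time_rational by measurable

lemma measurable_particle [measurable]: "(\<lambda>\<omega>. \<omega> p) \<in> model \<rightarrow>\<^sub>M walk_law"
  unfolding model_def by (rule measurable_component_singleton) simp

lemma activation_nonneg: "0 \<le> activation a \<eta> \<omega> x"
proof (induction "nat x" arbitrary: x rule: less_induct)
  case less
  have "0 \<le> hitting_time w z" for w z
    unfolding hitting_time_def by (intro Inf_greatest) auto
  then show ?case
    by (subst activation.simps) (auto intro!: INF_greatest add_nonneg_nonneg less)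
qed

lemma measurable_activation [measurable]:
  "(\<lambda>\<omega>. activation a \<eta> \<omega> x) \<in> borel_measurable model"
proof (induction "nat x" arbitrary: x rule: less_induct)
  case less
  show ?case
  proof (cases "x \<le> 0")
    case False
    then have [measurable]: "(\<lambda>\<omega>. activation a \<eta> \<omega> y) \<in> borel_measurable model" if "y \<in> {..<x}" for y
      using that less by auto
    show ?thesis using False
      by (subst activation.simps) (simp del: lessThan_iff, measurable)
  qed (simp add: activation.simps)
qed

lemma measurable_visited [measurable]: "Measurable.pred model (\<lambda>\<omega>. x \<in> visited a \<eta> \<omega> t)"
proof -
  let ?A = "\<lambda>\<omega> y. activation a \<eta> \<omega> y"
  have "x \<in> visited a \<eta> \<omega> t \<longleftrightarrow> (\<exists>y i. i < particles a \<eta> y \<and>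
      (?A \<omega> y \<le> ereal t \<and> x = y + walk (\<omega> (y, i)) (t - real_of_ereal (?A \<omega> y)) \<or>
       (\<exists>q::rat. 0 \<le> q \<and> ?A \<omega> y + ereal (real_of_rat q) \<le> ereal t \<and>
          x = y + walk (\<omega> (y, i)) (real_of_rat q))))" (is "_ \<longleftrightarrow> ?R") for \<omega>
  proof
    assume "x \<in> visited a \<eta> \<omega> t"
    then obtain y i s where s: "i < particles a \<eta> y" "0 \<le> s" "?A \<omega> y + ereal s \<le> ereal t"
      "x = y + walk (\<omega> (y, i)) s" unfolding visited_def by blast
    obtain r where r: "?A \<omega> y = ereal r" "0 \<le> r"
      using s(3) activation_nonneg[of a \<eta> \<omega> y] by (cases "?A \<omega> y") auto
    show ?R
    proof (cases "s = t - r")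
      case True
      then show ?thesis using s r by (intro exI[of _ y] exI[of _ i]) auto
    next
      case False
      then have "s < t - r" using s r by auto
      then obtain q :: rat where q: "s < real_of_rat q" "real_of_rat q < t - r"
        "walk (\<omega> (y, i)) (real_of_rat q) = walk (\<omega> (y, i)) s"
        using walk_at_rational[OF refl] by metis
      then have "0 < (real_of_rat q :: real)" using s by linarith
      then have "0 \<le> q" by simp
      then have "0 \<le> q \<and> ?A \<omega> y + ereal (real_of_rat q) \<le> ereal t \<and>
          x = y + walk (\<omega> (y, i)) (real_of_rat q)" using q s r by auto
      then show ?thesis using s(1) by blast
    qed
  next
    assume ?R
    then obtain y i where i: "i < particles a \<eta> y" and
      "?A \<omega> y \<le> ereal t \<and> x = y + walk (\<omega> (y, i)) (t - real_of_ereal (?A \<omega> y)) \<or>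
       (\<exists>q::rat. 0 \<le> q \<and> ?A \<omega> y + ereal (real_of_rat q) \<le> ereal t \<and>
          x = y + walk (\<omega> (y, i)) (real_of_rat q))" by blast
    then show "x \<in> visited a \<eta> \<omega> t"
    proof (elim disjE exE)
      assume A: "?A \<omega> y \<le> ereal t \<and> x = y + walk (\<omega> (y, i)) (t - real_of_ereal (?A \<omega> y))"
      then obtain r where r: "?A \<omega> y = ereal r" "0 \<le> r"
        using activation_nonneg[of a \<eta> \<omega> y] by (cases "?A \<omega> y") auto
      then show ?thesis using A i unfolding visited_def
        by (auto intro!: exI[of _ y] exI[of _ i] exI[of _ "t - r"])
    next
      fix q :: rat assume "0 \<le> q \<and> ?A \<omega> y + ereal (real_of_rat q) \<le> ereal t \<and>
          x = y + walk (\<omega> (y, i)) (real_of_rat q)"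
      then show ?thesis using i unfolding visited_def
        by (auto intro!: exI[of _ y] exI[of _ i] exI[of _ "real_of_rat q"])
    qed
  qed
  then show ?thesis by simp
qed

lemma measurable_front [measurable]: "(\<lambda>\<omega>. front a \<eta> \<omega> t) \<in> borel_measurable model"
proof -
  have "(SUP x\<in>visited a \<eta> \<omega> t. ereal (real_of_int x)) =
      (SUP x. if x \<in> visited a \<eta> \<omega> t then ereal (real_of_int x) else - \<infinity>)" for \<omega>
  proof (rule antisym)
    show "(SUP x\<in>visited a \<eta> \<omega> t. ereal (real_of_int x)) \<le>
        (SUP x. if x \<in> visited a \<eta> \<omega> t then ereal (real_of_int x) else - \<infinity>)"
    proof (rule SUP_least)
      fix x assume "x \<in> visited a \<eta> \<omega> t"
      then show "ereal (real_of_int x) \<le>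
          (SUP x. if x \<in> visited a \<eta> \<omega> t then ereal (real_of_int x) else - \<infinity>)"
        by (intro SUP_upper2[of x]) simp_all
    qed
  qed (rule SUP_least, auto intro: SUP_upper)
  then show ?thesis
    unfolding front_def by (simp only:) measurable
qed

end

theory Submission
  imports Defs
begin

text \<open>
  The Y particles play no role. A walk makes \<open>2 * n * q\<close> jumps, \<open>(n + j) * q\<close> of them upwards, with
  every holding time at most \<open>d\<close>, with probability at least \<open>p ^ q\<close>, where
  \<open>p = (2 * n choose (n + j)) * ((1 - exp (- 2 * d)) / 2) ^ (2 * n)\<close>; such a walk moves up by
  \<open>2 * j * q\<close> within time \<open>2 * n * d * q\<close>. Among the at least \<open>exp (\<theta> * j * q)\<close> X particles that
  start at \<open>- j * q\<close>, one does so, and reaches \<open>j * q\<close>, except with probability at most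
  \<open>exp (- (\<rho> ^ q))\<close>, where \<open>\<rho> = exp (\<theta> * j) * p\<close>. So whenever \<open>\<rho> > 1\<close> the front has speed at least
  \<open>j / (2 * n * d)\<close>. For given \<open>\<theta>\<close>, suitable \<open>n\<close>, \<open>j\<close> and a large \<open>d\<close> give \<open>\<rho> > 1\<close>, which is (i);
  for (ii) take \<open>n = j = 1\<close>, a small \<open>d\<close> to exceed the speed \<open>v\<close>, and then \<open>\<theta>'\<close> large.
\<close>

section \<open>Trajectories with a prescribed number of upward jumps\<close>

abbreviation step_law :: "(real \<times> int) measure" where
  "step_law \<equiv> density lborel (exponential_density 2) \<Otimes>\<^sub>M measure_pmf (pmf_of_set {-1, 1})"

lemma prob_space_step_law: "prob_space step_law"
  by (rule prob_space_pair[OF prob_space_exponential_density prob_space_measure_pmf]) simp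

lemma emeasure_exponential_density_Ioc:
  assumes "0 < l" "0 \<le> d"
  shows "emeasure (density lborel (exponential_density l)) {0<..d} = ennreal (1 - exp (- l * d))"
proof -
  let ?M = "density lborel (exponential_density l)"
  have E: "emeasure ?M {..x} = ennreal (1 - exp (- l * x))" if "0 \<le> x" for x
    using emeasure_erlang_density[OF assms(1), of 0 x] that by (simp add: erlang_CDF_0)
  have "{0<..d} = {..d} - {..0}" by auto
  then have "emeasure ?M {0<..d} = emeasure ?M {..d} - emeasure ?M {..0}"
    using assms E[of 0] by (simp add: emeasure_Diff)
  then show ?thesis using E assms by simp
qed

lemma emeasure_exponential_density_Ioi:
  assumes "0 < l"
  shows "emeasure (density lborel (exponential_density l)) {0<..} = 1"
proof -
  let ?M = "density lborel (exponential_density l)"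
  interpret prob_space ?M by (rule prob_space_exponential_density[OF assms])
  have "emeasure ?M {..0} = 0"
    using emeasure_erlang_density[OF assms(1), of 0 0] by (simp add: erlang_CDF_0)
  moreover have "{0<..} = space ?M - {..0}" by auto
  ultimately show ?thesis
    by (simp add: emeasure_compl[simplified] emeasure_Diff emeasure_space_1[simplified])
qed

lemma emeasure_step_law_step:
  assumes "0 \<le> d" "s \<in> {-1, 1}"
  shows "emeasure step_law ({0<..d} \<times> {s}) = ennreal ((1 - exp (- 2 * d)) / 2)"
proof -
  have s: "emeasure (measure_pmf (pmf_of_set {-1, 1})) {s} = ennreal (1 / 2)"
    using assms by (auto simp: emeasure_pmf_single pmf_of_set)
  have "emeasure step_law ({0<..d} \<times> {s}) = ennreal (1 - exp (- 2 * d)) * ennreal (1 / 2)"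
    using emeasure_exponential_density_Ioc[of 2 d] assms
    by (subst measure_pmf.emeasure_pair_measure_Times) (auto simp: s)
  also have "\<dots> = ennreal ((1 - exp (- 2 * d)) * (1 / 2))"
    using assms by (intro ennreal_mult[symmetric]) auto
  finally show ?thesis by simp
qed

lemma emeasure_step_law_positive: "emeasure step_law ({0<..} \<times> UNIV) = 1"
  using emeasure_exponential_density_Ioi[of 2]
    measure_pmf.emeasure_space_1[of "pmf_of_set {-1, 1::int}"]
  by (subst measure_pmf.emeasure_pair_measure_Times) auto

text \<open>The holding time with index \<open>m\<close> only has to be positive: this makes the walk rest, however
  briefly, at the site reached after \<open>m\<close> jumps.\<close>

definition jump_pattern :: "real \<Rightarrow> nat \<Rightarrow> nat set \<Rightarrow> trajectory set" where
  "jump_pattern d m A = {w \<in> space walk_law. \<forall>i\<in>{..m}.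
     w i \<in> (if i < m then {0<..d} \<times> {if i \<in> A then 1 else -1} else {0<..} \<times> UNIV)}"

definition up_jumps :: "real \<Rightarrow> nat \<Rightarrow> nat \<Rightarrow> trajectory set" where
  "up_jumps d m k = (\<Union>A\<in>{A. A \<subseteq> {..<m} \<and> card A = k}. jump_pattern d m A)"

lemma sets_jump_pattern [measurable]: "jump_pattern d m A \<in> sets walk_law"
proof -
  let ?X = "\<lambda>i. if i < m then {0<..d} \<times> {if i \<in> A then 1 else -1::int} else {0<..} \<times> UNIV"
  have [measurable]: "(\<lambda>w. w i) \<in> walk_law \<rightarrow>\<^sub>M step_law" for i
    unfolding walk_law_def by (rule measurable_component_singleton) simp
  have [measurable]: "?X i \<in> sets step_law" for i
    by auto
  show ?thesis unfolding jump_pattern_def by measurable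
qed

lemma sets_up_jumps [measurable]: "up_jumps d m k \<in> sets walk_law"
  unfolding up_jumps_def by (intro sets.finite_UN) auto

text \<open>The pattern constrains finitely many independent coordinates: each of the first
  \<open>m\<close> contributes the same factor whatever its direction, and the last one has
  probability 1.\<close>

lemma measure_jump_pattern:
  assumes "0 \<le> d"
  shows "measure walk_law (jump_pattern d m A) = ((1 - exp (- 2 * d)) / 2) ^ m"
proof -
  interpret product_prob_space "\<lambda>_. step_law" UNIV
    by (intro product_prob_spaceI prob_space_step_law)
  let ?X = "\<lambda>i. if i < m then {0<..d} \<times> {if i \<in> A then 1 else -1::int} else {0<..} \<times> UNIV"
  have "emeasure walk_law (jump_pattern d m A) = (\<Prod>i\<le>m. emeasure step_law (?X i))"
    unfolding jump_pattern_def walk_law_def by (rule emeasure_PiM_Collect) auto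
  also have "\<dots> = (\<Prod>i<m. emeasure step_law (?X i)) * emeasure step_law (?X m)"
    by (simp flip: lessThan_Suc_atMost)
  also have "\<dots> = (\<Prod>i<m. ennreal ((1 - exp (- 2 * d)) / 2))"
    using emeasure_step_law_step[OF assms] emeasure_step_law_positive by simp
  also have "\<dots> = ennreal (((1 - exp (- 2 * d)) / 2) ^ m)"
    using assms by (simp add: ennreal_power)
  finally show ?thesis using assms by (simp add: measure_def)
qed

text \<open>The set \<open>A\<close> can be read off the signs of the first \<open>m\<close> jumps,
  so patterns of distinct sets are disjoint and their \<open>m choose k\<close> equal probabilities
  add up.\<close>

lemma measure_up_jumps:
  assumes "0 \<le> d"
  shows "measure walk_law (up_jumps d m k) = real (m choose k) * ((1 - exp (- 2 * d)) / 2) ^ m"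
proof -
  interpret prob_space walk_law by (rule prob_space_walk_law)
  let ?S = "{A. A \<subseteq> {..<m} \<and> card A = k}"
  have "disjoint_family_on (jump_pattern d m) ?S"
    unfolding disjoint_family_on_def
  proof (intro ballI impI)
    fix A B assume "A \<in> ?S" "B \<in> ?S" "A \<noteq> B"
    then obtain i where i: "i < m" "i \<in> A \<longleftrightarrow> i \<notin> B" by blast
    then have "w \<notin> jump_pattern d m B" if "w \<in> jump_pattern d m A" for w
      using that by (auto simp: jump_pattern_def dest!: bspec[of _ _ i])
    then show "jump_pattern d m A \<inter> jump_pattern d m B = {}" by blast
  qed
  then have "prob (up_jumps d m k) = (\<Sum>A\<in>?S. prob (jump_pattern d m A))"
    unfolding up_jumps_def by (intro finite_measure_finite_Union) auto
  also have "\<dots> = real (card ?S) * ((1 - exp (- 2 * d)) / 2) ^ m"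
    using measure_jump_pattern[OF assms] by simp
  finally show ?thesis by (simp add: n_subsets)
qed

lemma up_jumps_reaches:
  assumes "w \<in> up_jumps d m k"
  obtains s where "0 \<le> s" "s \<le> real m * d" "walk w s = 2 * int k - int m"
proof -
  obtain A where A: "A \<subseteq> {..<m}" "card A = k" "w \<in> jump_pattern d m A"
    using assms by (auto simp: up_jumps_def)
  then have step: "0 < fst (w i)" "fst (w i) \<le> d" "snd (w i) = (if i \<in> A then 1 else -1)"
    if "i < m" for i
    using that by (auto simp: jump_pattern_def mem_Times_iff dest!: bspec[of _ _ i])
  have last: "0 < fst (w m)"
    using A by (auto simp: jump_pattern_def mem_Times_iff dest!: bspec[of _ _ m])
  \<comment> \<open>This is the time of the \<open>m\<close>-th jump.\<close>
  define s where "s = (\<Sum>j<m. fst (w j))"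
  have "0 \<le> s" unfolding s_def using step(1) by (intro sum_nonneg) (simp add: less_imp_le)
  moreover have "s \<le> real m * d"
    unfolding s_def using sum_bounded_above[of "{..<m}" "\<lambda>j. fst (w j)" d] step(2) by simp
  moreover have "jump_count w s = m"
    unfolding jump_count_def
  proof (rule Least_equality)
    show "s < (\<Sum>j\<le>m. fst (w j))" using last by (simp add: s_def flip: lessThan_Suc_atMost)
    fix l assume l: "s < (\<Sum>j\<le>l. fst (w j))"
    \<comment> \<open>The holding times before index \<open>m\<close> are nonnegative, so no shorter
      partial sum can exceed \<open>s\<close>.\<close>
    show "m \<le> l"
    proof (rule ccontr)
      assume "\<not> m \<le> l"
      then have "(\<Sum>j\<le>l. fst (w j)) \<le> s"
        unfolding s_def using step(1) by (intro sum_mono2) (auto simp: less_imp_le)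
      then show False using l by simp
    qed
  qed
  moreover have "(\<Sum>j<m. snd (w j)) = 2 * int k - int m"
  proof -
    have "(\<Sum>j<m. snd (w j)) = (\<Sum>j<m. 2 * (if j \<in> A then 1 else 0) - 1)"
      using step(3) by (intro sum.cong) auto
    also have "\<dots> = 2 * (\<Sum>j<m. (if j \<in> A then 1 else 0)) - int m"
      by (simp add: sum_subtractf sum_distrib_left)
    also have "(\<Sum>j<m. (if j \<in> A then 1 else 0)) = int (card A)"
      using A(1) by (simp add: sum.If_cases Int_absorb1)
    finally show ?thesis using A(2) by simp
  qed
  ultimately show ?thesis using that by (simp add: walk_def)
qed

section \<open>Binomial coefficients of concatenated blocks\<close>

text \<open>The product is a single term of the Vandermonde sum.\<close>

lemma binomial_mult_le: "(m choose k) * (n choose l) \<le> (m + n) choose (k + l)"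
proof -
  have "(m choose k) * (n choose (k + l - k)) \<le> (\<Sum>i\<le>k + l. (m choose i) * (n choose (k + l - i)))"
    by (rule member_le_sum[of k "{..k + l}" "\<lambda>i. (m choose i) * (n choose (k + l - i))"]) auto
  then show ?thesis by (simp add: vandermonde)
qed

text \<open>Concatenating \<open>q\<close> blocks, each of \<open>m\<close> jumps with
  \<open>k\<close> upward, yields admissible long patterns; hence the probability of the long event
  is at least a \<open>q\<close>-th power.\<close>

lemma binomial_power_le: "(m choose k) ^ q \<le> (m * q) choose (k * q)"
proof (induction q)
  case (Suc q)
  then show ?case
    using order_trans[OF mult_le_mono2[OF Suc] binomial_mult_le[of m k "m * q" "k * q"]] by simp
qed simp

section \<open>The front and the independent initial particles\<close>

lemma front_ge_of_up_jumps:
  assumes x: "x \<le> 0" and i: "i < \<eta> x" and w: "\<omega> (x, i) \<in> up_jumps d m k"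
    and t: "real m * d \<le> t" "0 < t"
  shows "front a \<eta> \<omega> t \<ge> ereal (real_of_int (x + 2 * int k - int m))"
proof -
  obtain s where s: "0 \<le> s" "s \<le> real m * d" "walk (\<omega> (x, i)) s = 2 * int k - int m"
    using up_jumps_reaches[OF w] .
  have "activation a \<eta> \<omega> x = 0" using x by (simp add: activation.simps)
  then have "x + 2 * int k - int m \<in> visited a \<eta> \<omega> t"
    unfolding visited_def using s t x i
    by (auto intro!: exI[of _ x] exI[of _ i] exI[of _ s] simp: particles_def)
  then have "ereal (real_of_int (x + 2 * int k - int m)) \<le> (SUP y\<in>visited a \<eta> \<omega> t. ereal (real_of_int y))"
    by (rule SUP_upper)
  then show ?thesis using t by (simp add: front_def)
qed

text \<open>Time 0 is excluded because the front is 0 there by convention, while right afterwards it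
  may be negative if no particle starts close to the origin.\<close>

lemma front_mono:
  assumes "0 < s" "s \<le> t"
  shows "front a \<eta> \<omega> s \<le> front a \<eta> \<omega> t"
proof -
  have "visited a \<eta> \<omega> s \<subseteq> visited a \<eta> \<omega> t"
    unfolding visited_def using assms by (blast intro: order_trans[of _ "ereal s"] ereal_less_eq(3)[THEN iffD2])
  then show ?thesis using assms by (auto simp: front_def intro!: SUP_subset_mono)
qed

lemma measure_no_up_jumps:
  "measure model {\<omega> \<in> space model. \<forall>i<n. \<omega> (x, i) \<notin> up_jumps d m k} =
     (1 - measure walk_law (up_jumps d m k)) ^ n"
proof -
  interpret W: prob_space walk_law by (rule prob_space_walk_law)
  interpret product_prob_space "\<lambda>_. walk_law" UNIV
    by (intro product_prob_spaceI prob_space_walk_law)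
  let ?B = "space walk_law - up_jumps d m k" and ?J = "Pair x ` {..<n}"
  have "emeasure model {\<omega> \<in> space model. \<forall>p\<in>?J. \<omega> p \<in> ?B} = (\<Prod>p\<in>?J. emeasure walk_law ?B)"
    unfolding model_def by (rule emeasure_PiM_Collect) auto
  also have "{\<omega> \<in> space model. \<forall>p\<in>?J. \<omega> p \<in> ?B} =
      {\<omega> \<in> space model. \<forall>i<n. \<omega> (x, i) \<notin> up_jumps d m k}"
    by (auto simp: model_def space_PiM)
  also have "(\<Prod>p\<in>?J. emeasure walk_law ?B) = ennreal ((1 - W.prob (up_jumps d m k)) ^ n)"
    by (simp add: card_image inj_on_def W.emeasure_eq_measure W.prob_compl ennreal_power)
  finally show ?thesis by (rule measure_eq_emeasure_eq_ennreal[rotated]) simp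
qed

text \<open>Let \<open>P\<close> be the probability of the up-jump event and \<open>N\<close> the
  number of particles at \<open>- int (j * q)\<close>. If the front stays below
  \<open>j * q\<close>, all \<open>N\<close> independent walks miss the event, which has probability
  \<open>(1 - P) ^ N\<close>, at most \<open>exp (- N * P)\<close>; and \<open>N * P\<close> is at
  least \<open>\<rho> ^ q\<close>.\<close>

lemma measure_front_less_le:
  fixes q :: nat
  assumes d: "0 < d" and "0 < n" "0 < q"
    and \<eta>: "exp (\<theta> * real (j * q)) \<le> real (\<eta> (- int (j * q)))"
  defines "\<rho> \<equiv> exp (\<theta> * real j) * (real (2 * n choose (n + j)) * ((1 - exp (- 2 * d)) / 2) ^ (2 * n))"
  shows "measure model {\<omega> \<in> space model. front a \<eta> \<omega> (real (2 * n * q) * d) < ereal (real (j * q))}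
    \<le> exp (- (\<rho> ^ q))"
proof -
  interpret W: prob_space walk_law by (rule prob_space_walk_law)
  interpret prob_space model by (rule prob_space_model)
  let ?G = "up_jumps d (2 * n * q) ((n + j) * q)" and ?x = "- int (j * q)"
  let ?c = "(1 - exp (- 2 * d)) / 2"
  have c: "0 \<le> ?c" using d by simp
  have start: "?x + 2 * int ((n + j) * q) - int (2 * n * q) = int (j * q)"
    by (simp add: algebra_simps)
  have "measure model {\<omega> \<in> space model. front a \<eta> \<omega> (real (2 * n * q) * d) < ereal (real (j * q))}
      \<le> measure model {\<omega> \<in> space model. \<forall>i<\<eta> ?x. \<omega> (?x, i) \<notin> ?G}"
  proof (rule finite_measure_mono)
    show "{\<omega> \<in> space model. front a \<eta> \<omega> (real (2 * n * q) * d) < ereal (real (j * q))}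
        \<subseteq> {\<omega> \<in> space model. \<forall>i<\<eta> ?x. \<omega> (?x, i) \<notin> ?G}"
    proof safe
      fix \<omega> i
      assume "i < \<eta> ?x" "\<omega> (?x, i) \<in> ?G"
      then have "ereal (real_of_int (?x + 2 * int ((n + j) * q) - int (2 * n * q)))
          \<le> front a \<eta> \<omega> (real (2 * n * q) * d)"
        using assms(1-3) by (intro front_ge_of_up_jumps) auto
      then have "ereal (real_of_int (int (j * q))) \<le> front a \<eta> \<omega> (real (2 * n * q) * d)"
        by (simp only: start)
      moreover assume "front a \<eta> \<omega> (real (2 * n * q) * d) < ereal (real (j * q))"
      ultimately show False by simp
    qed
  qed measurable
  also have "\<dots> = (1 - W.prob ?G) ^ \<eta> ?x" by (rule measure_no_up_jumps)
  also have "\<dots> \<le> exp (- W.prob ?G) ^ \<eta> ?x"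
    using exp_ge_add_one_self[of "- W.prob ?G"] by (intro power_mono) auto
  also have "\<dots> = exp (- (real (\<eta> ?x) * W.prob ?G))"
    by (simp flip: exp_of_nat_mult)
  also have "\<dots> \<le> exp (- (\<rho> ^ q))"
  proof -
    have "(real (2 * n choose (n + j)) * ?c ^ (2 * n)) ^ q = real ((2 * n choose (n + j)) ^ q) * ?c ^ (2 * n * q)"
      by (simp add: power_mult_distrib power_mult)
    also have "\<dots> \<le> W.prob ?G"
      using binomial_power_le[of "2 * n" "n + j" q] c d
      by (subst measure_up_jumps) (auto intro!: mult_right_mono simp del: of_nat_power)
    finally have G: "(real (2 * n choose (n + j)) * ?c ^ (2 * n)) ^ q \<le> W.prob ?G" .
    have "\<rho> ^ q = exp (\<theta> * real (j * q)) * (real (2 * n choose (n + j)) * ?c ^ (2 * n)) ^ q"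
      by (simp add: \<rho>_def power_mult_distrib mult.assoc mult.commute mult.left_commute flip: exp_of_nat_mult)
    also have "\<dots> \<le> real (\<eta> ?x) * W.prob ?G"
      using c by (intro mult_mono \<eta> G) auto
    finally show ?thesis by simp
  qed
  finally show ?thesis .
qed

section \<open>Choice of \<open>n\<close> and \<open>j\<close> for a given exponent\<close>

text \<open>If every term were at most \<open>4 ^ n\<close>, then the binomial expansion of
  \<open>((1 + exp \<theta>)\<^sup>2 / exp \<theta>) ^ n\<close> would be at most \<open>(1 + n) * 4 ^ n\<close>, whereas
  \<open>(1 + exp \<theta>)\<^sup>2 > 4 * exp \<theta>\<close>.\<close>

lemma exists_binomial_exp_gt:
  fixes \<theta> :: real
  assumes "0 < \<theta>"
  obtains n j where "0 < n" "0 < j" "4 ^ n < exp (\<theta> * real j) * real (2 * n choose (n + j))"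
proof (rule ccontr)
  note witness = that
  assume contra: "\<not> thesis"
  \<comment> \<open>Here \<open>4 * \<kappa>\<close> is the base of the binomial expansion below. As
    \<open>\<kappa> > 1\<close>, some power \<open>\<kappa> ^ n\<close> beats the linear factor
    \<open>1 + real n\<close>.\<close>
  define \<kappa> where "\<kappa> = (1 + exp \<theta>)\<^sup>2 / (4 * exp \<theta>)"
  have "0 < (exp \<theta> - 1)\<^sup>2" using assms by simp
  then have "4 * exp \<theta> < (1 + exp \<theta>)\<^sup>2" by (simp add: power2_eq_square algebra_simps)
  then have "1 < \<kappa>" by (simp add: \<kappa>_def)
  then have "(\<lambda>n. (1 + real n) / \<kappa> ^ n) \<longlonglongrightarrow> 0"
    using tendsto_add[OF LIMSEQ_inverse_realpow_zero[OF \<open>1 < \<kappa>\<close>] lim_n_over_pown[of \<kappa>]]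
    by (simp add: add_divide_distrib inverse_eq_divide)
  then have "eventually (\<lambda>n. (1 + real n) / \<kappa> ^ n < 1) sequentially"
    by (rule order_tendstoD) simp
  then have "eventually (\<lambda>n. (1 + real n) / \<kappa> ^ n < 1 \<and> 0 < n) sequentially"
    using eventually_gt_at_top[of 0] by eventually_elim simp
  then obtain n where n: "(1 + real n) / \<kappa> ^ n < 1" "0 < n"
    by (auto simp: eventually_sequentially)
  have upper: "exp (\<theta> * (real k - real n)) * real (2 * n choose k) \<le> 4 ^ n" if "n < k" for k
    using contra witness[of n "k - n"] n that by (force simp: of_nat_diff)
  have "(4 * \<kappa>) ^ n = (exp \<theta> + 1) ^ (2 * n) / exp (\<theta> * real n)"
    by (simp add: \<kappa>_def power_divide power_mult exp_of_nat2_mult add.commute)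
  also have "\<dots> = (\<Sum>k\<le>2 * n. exp (\<theta> * (real k - real n)) * real (2 * n choose k))"
    unfolding binomial_ring sum_divide_distrib
    by (intro sum.cong) (simp_all add: right_diff_distrib exp_diff exp_of_nat2_mult)
  also have "\<dots> = (\<Sum>k\<le>n. exp (\<theta> * (real k - real n)) * real (2 * n choose k)) +
      (\<Sum>k=Suc n..2 * n. exp (\<theta> * (real k - real n)) * real (2 * n choose k))"
    by (subst sum.union_disjoint[symmetric]) (auto intro!: sum.cong)
  \<comment> \<open>For \<open>k \<le> n\<close> the exponential factor is at most 1; for larger
    \<open>k\<close> the assumed bound applies with \<open>j = k - n\<close>.\<close>
  also have "\<dots> \<le> (\<Sum>k\<le>n. real (2 * n choose k)) + (\<Sum>k=Suc n..2 * n. 4 ^ n)"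
    using upper assms
    by (intro add_mono sum_mono mult_left_le_one_le) (auto simp: mult_nonneg_nonpos)
  also have "\<dots> \<le> (\<Sum>k\<le>2 * n. real (2 * n choose k)) + (\<Sum>k=Suc n..2 * n. 4 ^ n)"
    by (intro add_mono sum_mono2) auto
  \<comment> \<open>The full row sums to \<open>2 ^ (2 * n)\<close>, and the second sum has
    \<open>n\<close> equal terms.\<close>
  also have "\<dots> = 4 ^ n * (1 + real n)"
    by (subst of_nat_sum[symmetric], subst choose_row_sum) (simp add: power_mult distrib_left)
  finally have "\<kappa> ^ n \<le> 1 + real n" by (simp add: power_mult_distrib)
  then show False using n \<open>1 < \<kappa>\<close> by (simp add: field_simps)
qed

section \<open>Exponential bounds along an arithmetic sequence of times\<close>

lemma eventually_exp_le_of_Liminf: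
  assumes "Liminf at_bot (\<lambda>x::int. ereal (real (\<eta> x) * exp (\<theta> * real_of_int x))) = \<infinity>"
    and "0 < j"
  shows "eventually (\<lambda>q. exp (\<theta> * real (j * q)) \<le> real (\<eta> (- int (j * q)))) sequentially"
proof -
  have "eventually (\<lambda>x::int. 1 < ereal (real (\<eta> x) * exp (\<theta> * real_of_int x))) at_bot"
    using assms(1) by (intro less_LiminfD) simp
  moreover have "filterlim (\<lambda>q. - int (j * q)) at_bot sequentially"
    unfolding filterlim_at_bot
  proof
    fix Z :: int
    show "eventually (\<lambda>q. - int (j * q) \<le> Z) sequentially"
      using eventually_ge_at_top[of "nat (- Z)"]
    proof eventually_elim
      case (elim q)
      have "q \<le> j * q" using assms(2) by simp
      then have "int q \<le> int (j * q)" by (simp only: of_nat_le_iff)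
      then show ?case using elim by linarith
    qed
  qed
  ultimately have "eventually (\<lambda>q. 1 < ereal (real (\<eta> (- int (j * q))) *
      exp (\<theta> * real_of_int (- int (j * q))))) sequentially"
    by (rule eventually_compose_filterlim)
  then show ?thesis
    by eventually_elim (simp add: exp_minus field_simps)
qed

text \<open>Bernoulli's inequality gives \<open>\<rho> ^ q \<ge> 1 + q * (\<rho> - 1)\<close>, which
  turns the doubly exponential bound into a plain exponential one of rate
  \<open>\<rho> - 1\<close>.\<close>

lemma eventually_measure_front_less_le:
  assumes "0 < d" "0 < n" "0 < j"
    and \<rho>: "1 < exp (\<theta> * real j) * (real (2 * n choose (n + j)) * ((1 - exp (- 2 * d)) / 2) ^ (2 * n))"
    and "Liminf at_bot (\<lambda>x::int. ereal (real (\<eta> x) * exp (\<theta> * real_of_int x))) = \<infinity>"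
  obtains c where "0 < c" "eventually (\<lambda>q. measure model {\<omega> \<in> space model.
      front a \<eta> \<omega> (real q * (real (2 * n) * d)) < ereal (real (j * q))} \<le> exp (- c * real q)) sequentially"
proof -
  define \<rho> where "\<rho> = exp (\<theta> * real j) *
    (real (2 * n choose (n + j)) * ((1 - exp (- 2 * d)) / 2) ^ (2 * n))"
  have "1 < \<rho>" using \<rho> by (simp add: \<rho>_def)
  have "eventually (\<lambda>q. measure model {\<omega> \<in> space model.
      front a \<eta> \<omega> (real q * (real (2 * n) * d)) < ereal (real (j * q))} \<le> exp (- (\<rho> - 1) * real q)) sequentially"
    using eventually_exp_le_of_Liminf[OF assms(5,3)] eventually_gt_at_top[of 0]
  proof eventually_elim
    case (elim q)
    have "measure model {\<omega> \<in> space model.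
        front a \<eta> \<omega> (real q * (real (2 * n) * d)) < ereal (real (j * q))} \<le> exp (- (\<rho> ^ q))"
      using measure_front_less_le[OF assms(1,2) elim(2), where j = j and \<theta> = \<theta> and \<eta> = \<eta> and a = a] elim(1)
      by (simp add: \<rho>_def mult_ac)
    also have "\<dots> \<le> exp (- (\<rho> - 1) * real q)"
      using Bernoulli_inequality[of "\<rho> - 1" q] \<open>1 < \<rho>\<close> by (simp add: algebra_simps)
    finally show ?case .
  qed
  then show ?thesis using that[of "\<rho> - 1"] \<open>1 < \<rho>\<close> by simp
qed

section \<open>Passage to continuous time\<close>

text \<open>Round \<open>t\<close> down to a multiple of \<open>D\<close> and use monotonicity;
  rounding costs at most \<open>j\<close>. The condition \<open>D \<le> t\<close> makes that
  multiple positive, as monotonicity requires.\<close>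

lemma front_ge_between:
  fixes t D :: real and j :: nat
  assumes "0 < D" "D \<le> t"
    and "front a \<eta> \<omega> (real (nat \<lfloor>t / D\<rfloor>) * D) \<ge> ereal (real (j * nat \<lfloor>t / D\<rfloor>))"
  shows "front a \<eta> \<omega> t \<ge> ereal (real j * (t / D - 1))"
proof -
  define q where "q = nat \<lfloor>t / D\<rfloor>"
  have "1 \<le> t / D" using assms by simp
  then have q: "real q \<le> t / D" "t / D - 1 \<le> real q" "0 < q"
    unfolding q_def by linarith+
  then have "0 < real q * D" "real q * D \<le> t" using assms(1) by (auto simp: field_simps)
  then have "front a \<eta> \<omega> (real q * D) \<le> front a \<eta> \<omega> t" by (rule front_mono)
  moreover have "ereal (real j * (t / D - 1)) \<le> ereal (real (j * q))"
    using q(2) by (simp add: mult_left_mono)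
  ultimately show ?thesis using assms(3) unfolding q_def[symmetric] by (meson order_trans)
qed

lemma filterlim_nat_floor_divide:
  fixes D :: real
  assumes "0 < D"
  shows "filterlim (\<lambda>t. nat \<lfloor>t / D\<rfloor>) sequentially at_top"
  unfolding filterlim_at_top
proof
  fix Z
  show "eventually (\<lambda>t. Z \<le> nat \<lfloor>t / D\<rfloor>) at_top"
    using eventually_ge_at_top[of "real Z * D"]
  proof eventually_elim
    case (elim t)
    then have "real Z \<le> t / D" using assms by (simp add: field_simps)
    then show ?case by linarith
  qed
qed

text \<open>For \<open>t \<ge> 2 * D\<close> the rounded index is at least
  \<open>t / (2 * D)\<close>, whence the rate \<open>c / (2 * D)\<close>. A quarter of the speed
  \<open>j / D\<close> leaves room for rounding, since \<open>t / D - 1\<close> exceeds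
  \<open>(t / D) / 4\<close> as soon as \<open>t / D \<ge> 2\<close>.\<close>

lemma Limsup_ereal_ln_front_less_0:
  assumes "0 < c" "0 < D" "0 < j"
    and ev: "eventually (\<lambda>q. measure model {\<omega> \<in> space model.
      front a \<eta> \<omega> (real q * D) < ereal (real (j * q))} \<le> exp (- c * real q)) sequentially"
  shows "Limsup at_top (\<lambda>t::real. ereal (1 / t) * ereal_ln (measure model
    {\<omega> \<in> space model. front a \<eta> \<omega> t / ereal t \<le> ereal (real j / (4 * D))})) < 0"
proof -
  interpret prob_space model by (rule prob_space_model)
  have "eventually (\<lambda>t. ereal (1 / t) * ereal_ln (measure model
    {\<omega> \<in> space model. front a \<eta> \<omega> t / ereal t \<le> ereal (real j / (4 * D))}) \<le> ereal (- c / (2 * D))) at_top"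
    using eventually_compose_filterlim[OF ev filterlim_nat_floor_divide[OF assms(2)]]
      eventually_ge_at_top[of "2 * D"]
  proof eventually_elim
    case (elim t)
    define q where "q = nat \<lfloor>t / D\<rfloor>"
    define p where "p = prob {\<omega> \<in> space model. front a \<eta> \<omega> t / ereal t \<le> ereal (real j / (4 * D))}"
    have t: "0 < t" using elim assms by linarith
    have "2 \<le> t / D" using elim assms(2) by (simp add: field_simps)
    then have q: "t / (2 * D) \<le> real q" unfolding q_def by linarith
    have "p \<le> prob {\<omega> \<in> space model. front a \<eta> \<omega> (real q * D) < ereal (real (j * q))}"
      unfolding p_def
    proof (rule finite_measure_mono)
      show "{\<omega> \<in> space model. front a \<eta> \<omega> t / ereal t \<le> ereal (real j / (4 * D))} \<subseteq>
          {\<omega> \<in> space model. front a \<eta> \<omega> (real q * D) < ereal (real (j * q))}"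
      proof (safe, rule ccontr)
        fix \<omega> assume \<omega>: "front a \<eta> \<omega> t / ereal t \<le> ereal (real j / (4 * D))"
          "\<not> front a \<eta> \<omega> (real q * D) < ereal (real (j * q))"
        have "ereal (real j * (t / D - 1)) \<le> front a \<eta> \<omega> t"
          using front_ge_between[of D t j a \<eta> \<omega>] \<omega>(2) assms(2) elim(2) by (simp add: q_def not_less)
        also have "\<dots> \<le> ereal t * ereal (real j / (4 * D))"
          using \<omega>(1) t by (simp add: ereal_divide_le_pos)
        finally have "real j * (t / D - 1) \<le> real j * (1 / 4 * (t / D))" by (simp add: field_simps)
        then have "t / D - 1 \<le> 1 / 4 * (t / D)" using assms(3) by (simp only: mult_le_cancel_left_pos of_nat_0_less_iff)
        then show False using \<open>2 \<le> t / D\<close> by linarith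
      qed
    qed measurable
    also have "\<dots> \<le> exp (- c * real q)" using elim(1) by (simp add: q_def)
    also have "\<dots> \<le> exp (- c * (t / (2 * D)))" using mult_left_mono[OF q, of c] assms(1) by simp
    finally have p: "p \<le> exp (- c * (t / (2 * D)))" .
    \<comment> \<open>If \<open>p\<close> is 0, the left side is minus infinity.\<close>
    have "ereal (1 / t) * ereal_ln p \<le> ereal (- c / (2 * D))"
    proof (cases "p \<le> 0")
      case False
      then have "ln p \<le> ln (exp (- c * (t / (2 * D))))" using p by (subst ln_le_cancel_iff) auto
      then have "ln p \<le> - c * (t / (2 * D))" by simp
      then show ?thesis using False t by (simp add: ereal_ln_def field_simps)
    qed (use t in \<open>simp add: ereal_ln_def\<close>)
    then show ?case unfolding p_def .
  qed
  then have "Limsup at_top (\<lambda>t::real. ereal (1 / t) * ereal_ln (measure model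
    {\<omega> \<in> space model. front a \<eta> \<omega> t / ereal t \<le> ereal (real j / (4 * D))})) \<le> ereal (- c / (2 * D))"
    by (rule Limsup_bounded)
  also have "\<dots> < 0" using assms by simp
  finally show ?thesis .
qed

text \<open>The bounds form a geometric series, so by Borel-Cantelli the front almost surely lags
  behind \<open>j * q\<close> at time \<open>q * D\<close> for only finitely many \<open>q\<close>;
  rounding then handles the times in between.\<close>

lemma AE_Liminf_front_ge:
  assumes "0 < c" "0 < D" "0 < j" "v' < real j / D"
    and ev: "eventually (\<lambda>q. measure model {\<omega> \<in> space model.
      front a \<eta> \<omega> (real q * D) < ereal (real (j * q))} \<le> exp (- c * real q)) sequentially"
  shows "AE \<omega> in model. Liminf at_top (\<lambda>t::real. front a \<eta> \<omega> t / ereal t) \<ge> ereal v'"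
proof -
  interpret prob_space model by (rule prob_space_model)
  let ?A = "\<lambda>q. {\<omega> \<in> space model. front a \<eta> \<omega> (real q * D) < ereal (real (j * q))}"
  have "summable (\<lambda>q. exp (- c) ^ q)" using assms(1) by (intro summable_geometric) simp
  then have "summable (\<lambda>q. prob (?A q))"
    by (rule summable_comparison_test_ev[rotated])
      (use ev in \<open>simp add: exp_of_nat2_mult[symmetric]\<close>)
  then have "AE \<omega> in model. eventually (\<lambda>q. \<omega> \<in> space model - ?A q) sequentially"
    by (intro borel_cantelli_AE1) (auto simp: emeasure_eq_measure)
  then show ?thesis
  proof eventually_elim
    case (elim \<omega>)
    then have "eventually (\<lambda>q. front a \<eta> \<omega> (real q * D) \<ge> ereal (real (j * q))) sequentially"
      by eventually_elim auto
    \<comment> \<open>From \<open>t = j / (j / D - v')\<close> on, the rounding loss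
      \<open>j\<close> is covered by the gap between \<open>v'\<close> and
      \<open>j / D\<close>.\<close>
    from eventually_compose_filterlim[OF this filterlim_nat_floor_divide[OF assms(2)]]
    have "eventually (\<lambda>t. ereal v' \<le> front a \<eta> \<omega> t / ereal t) at_top"
      using eventually_ge_at_top[of D] eventually_ge_at_top[of "real j / (real j / D - v')"]
    proof eventually_elim
      case (elim t)
      have t: "0 < t" using elim assms by linarith
      have "v' * t \<le> real j * (t / D - 1)"
        using elim(3) assms(4) by (simp add: pos_divide_le_eq algebra_simps)
      then have "ereal t * ereal v' \<le> ereal (real j * (t / D - 1))" by (simp add: mult.commute)
      also have "\<dots> \<le> front a \<eta> \<omega> t" by (rule front_ge_between[OF assms(2) elim(2,1)])
      finally show ?case using t by (simp add: ereal_le_divide_pos)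
    qed
    then show ?case by (rule Liminf_bounded)
  qed
qed

section \<open>Choice of the constants for both assertions\<close>

theorem theorem3:
  fixes a :: nat and v :: real
  assumes "a \<ge> 1" and "is_velocity a v"
  shows
    "(\<forall>\<eta>. initial_condition \<eta> \<and> (\<exists>\<theta>\<^sub>0>0. exp_summable \<theta>\<^sub>0 \<eta>) \<and>
        (\<exists>\<theta>>0. Liminf at_bot (\<lambda>x::int. ereal (real (\<eta> x) * exp (\<theta> * real_of_int x))) = \<infinity>) \<longrightarrow>
        (\<exists>b::real. b > 0 \<and>
          Limsup at_top (\<lambda>t::real. ereal (1 / t) *
            ereal_ln (measure model {\<omega> \<in> space model. front a \<eta> \<omega> t / ereal t \<le> ereal b})) < 0)) \<and>
     (\<exists>\<theta>'>0. \<exists>v'>v. \<forall>\<eta>. initial_condition \<eta> \<and> (\<exists>\<theta>\<^sub>0>0. exp_summable \<theta>\<^sub>0 \<eta>) \<and>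
        Liminf at_bot (\<lambda>x::int. ereal (real (\<eta> x) * exp (\<theta>' * real_of_int x))) = \<infinity> \<longrightarrow>
        (AE \<omega> in model. Liminf at_top (\<lambda>t::real. front a \<eta> \<omega> t / ereal t) \<ge> ereal v'))"
proof (rule conjI, safe)
  fix \<eta> and \<theta> :: real
  assume \<theta>: "0 < \<theta>"
    and \<eta>: "Liminf at_bot (\<lambda>x::int. ereal (real (\<eta> x) * exp (\<theta> * real_of_int x))) = \<infinity>"
  obtain n j where nj: "0 < n" "0 < j" "4 ^ n < exp (\<theta> * real j) * real (2 * n choose (n + j))"
    using exists_binomial_exp_gt[OF \<theta>] .
  let ?r = "\<lambda>d. exp (\<theta> * real j) * (real (2 * n choose (n + j)) * ((1 - exp (- 2 * d)) / 2) ^ (2 * n))"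
  \<comment> \<open>As \<open>d\<close> grows, the bound on the holding times ceases to cost
    anything: each jump factor tends to 1/2, and the limit of \<open>?r\<close> exceeds 1 by the
    choice of \<open>n\<close> and \<open>j\<close>.\<close>
  have "((\<lambda>d::real. exp (- 2 * d)) \<longlongrightarrow> 0) at_top"
    by (rule filterlim_compose[OF exp_at_bot]) (simp add: filterlim_uminus_at_bot filterlim_tendsto_pos_mult_at_top[OF tendsto_const _ filterlim_ident])
  then have "(?r \<longlongrightarrow> exp (\<theta> * real j) * (real (2 * n choose (n + j)) * ((1 - 0) / 2) ^ (2 * n))) at_top"
    by (intro tendsto_intros) auto
  moreover have "1 < exp (\<theta> * real j) * (real (2 * n choose (n + j)) * ((1 - 0) / 2) ^ (2 * n))"
    using nj(3) by (simp add: power_divide power_mult)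
  ultimately have "eventually (\<lambda>d. 1 < ?r d) at_top" by (rule order_tendstoD)
  then have "eventually (\<lambda>d. 1 < ?r d \<and> 0 < d) at_top"
    using eventually_gt_at_top[of 0] by eventually_elim simp
  then obtain d where d: "1 < ?r d" "0 < d" by (auto simp: eventually_at_top_linorder)
  obtain c where c: "0 < c" "eventually (\<lambda>q. measure model {\<omega> \<in> space model.
      front a \<eta> \<omega> (real q * (real (2 * n) * d)) < ereal (real (j * q))} \<le> exp (- c * real q)) sequentially"
    using eventually_measure_front_less_le[OF d(2) nj(1,2) d(1) \<eta>] .
  have D: "0 < real (2 * n) * d" using nj d by simp
  show "\<exists>b>0. Limsup at_top (\<lambda>t::real. ereal (1 / t) *
      ereal_ln (measure model {\<omega> \<in> space model. front a \<eta> \<omega> t / ereal t \<le> ereal b})) < 0"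
    using Limsup_ereal_ln_front_less_0[OF c(1) D nj(2) c(2)] D nj(2)
    by (intro exI[of _ "real j / (4 * (real (2 * n) * d))"] conjI) (simp_all del: of_nat_mult)
next
  have v: "0 < v" using assms(2) by (simp add: is_velocity_def)
  \<comment> \<open>With \<open>n = j = 1\<close> the speed \<open>1 / (2 * d)\<close> equals
    \<open>v + 2\<close>, which lies above the target \<open>v' = v + 1\<close>.\<close>
  define d where "d = 1 / (2 * (v + 2))"
  define p where "p = ((1 - exp (- 2 * d)) / 2) ^ 2"
  \<comment> \<open>The logarithm gives \<open>exp \<theta>' * p \<ge> 2\<close>, and the maximum
    with 1 ensures positivity. Since \<open>p\<close> depends only on \<open>v\<close>, so does
    \<open>\<theta>'\<close>; thus it is chosen before \<open>\<eta>\<close>.\<close>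
  define \<theta>' where "\<theta>' = max 1 (ln (2 / p))"
  have d: "0 < d" using v by (simp add: d_def)
  then have p: "0 < p" by (simp add: p_def)
  have "2 / p \<le> exp \<theta>'"
    using p exp_le_cancel_iff[of "ln (2 / p)" \<theta>'] by (simp add: \<theta>'_def del: exp_le_cancel_iff)
  then have "1 < exp \<theta>' * p"
    using p by (simp add: field_simps)
  then have \<rho>: "1 < exp (\<theta>' * real 1) * (real (2 * 1 choose (1 + 1)) * ((1 - exp (- 2 * d)) / 2) ^ (2 * 1))"
    by (simp add: p_def numeral_2_eq_2)
  have D: "0 < real (2 * 1) * d" "v + 1 < real 1 / (real (2 * 1) * d)"
    using d v by (simp_all add: d_def)
  have "AE \<omega> in model. Liminf at_top (\<lambda>t::real. front a \<eta> \<omega> t / ereal t) \<ge> ereal (v + 1)"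
    if \<eta>: "Liminf at_bot (\<lambda>x::int. ereal (real (\<eta> x) * exp (\<theta>' * real_of_int x))) = \<infinity>" for \<eta>
  proof -
    obtain c where c: "0 < c" "eventually (\<lambda>q. measure model {\<omega> \<in> space model.
        front a \<eta> \<omega> (real q * (real (2 * 1) * d)) < ereal (real (1 * q))} \<le> exp (- c * real q)) sequentially"
      using eventually_measure_front_less_le[OF d zero_less_one zero_less_one \<rho> \<eta>] .
    show ?thesis by (rule AE_Liminf_front_ge[OF c(1) D(1) zero_less_one D(2) c(2)])
  qed
  moreover have "0 < \<theta>'" "v < v + 1" by (simp_all add: \<theta>'_def)
  ultimately show "\<exists>\<theta>'>0. \<exists>v'>v. \<forall>\<eta>. initial_condition \<eta> \<and> (\<exists>\<theta>\<^sub>0>0. exp_summable \<theta>\<^sub>0 \<eta>) \<and>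
        Liminf at_bot (\<lambda>x::int. ereal (real (\<eta> x) * exp (\<theta>' * real_of_int x))) = \<infinity> \<longrightarrow>
        (AE \<omega> in model. Liminf at_top (\<lambda>t::real. front a \<eta> \<omega> t / ereal t) \<ge> ereal v')"
    by blast
qed

end
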